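(* There is a two-dimensional continued fraction expansion $\mu^*$ and a dense subset $\mathcal D$ of $\mathbb R^2$ consisting of rank 3 points such that for every $x=(\alpha,\beta)\in\mathcal D$, writing $\mu^*(x)=E^*_0,E^*_1,\dots$ and letting $v^*_{ni}=(p^*_{ni}/d^*_{ni},q^*_{ni}/d^*_{ni})$ denote the $i$th vertex of $E^*_n$ ($i=1,2,3$), the following hold. (a) All angles of every triangle $E^*_n$ are $>\arcsin(23^{1/2}/6)$, and $$\lim_{n\to\infty}\frac{\max_{i=1,2,3}\operatorname{dist}(x,v^*_{ni})}{(2d^*_{n1}d^*_{n2}d^*_{n3})^{-1/2}}\leq\lim_{n\to\infty}\frac{\operatorname{diam}(E^*_n)}{\operatorname{area}(E^*_n)^{1/2}}<2\cdot\left(\frac{13}{23}\right)^{1/4}.$$ (b) Let $\rho\subseteq\mathbb R^3$ be the half-line originating at $(0,0,0)$ and passing through $(\alpha,\beta,1)$. For each $n=0,1,\dots$ pick a vertex $v^*_n=(p^*_n/d^*_n,q^*_n/d^*_n)$ of $E^*_n$ having smallest denominator among the vertices of $E^*_n$. Then the sequence $v^*_0,v^*_1,\dots$ strongly converges to $x$, in the sense that $\lim_{n\to\infty}\operatorname{dist}(\rho,(p^*_n,q^*_n,d^*_n))=0$.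
   Context: A two-dimensional continued fraction expansion is a map $\mu$ assigning to every $x\in\mathbb R^2\setminus\mathbb Q^2$ a sequence $\mu(x)=T_0,T_1,\dots$ of triangles $T_n\subseteq\mathbb R^2$ with rational vertices $(p_{ni}/d_{ni},q_{ni}/d_{ni})$, where $p_{ni},q_{ni},d_{ni}\in\mathbb Z$, $d_{ni}>0$, $i=1,2,3$, such that $\bigcap_n T_n=\{x\}$ and, for every $n$, the $3\times3$ integer matrix with rows $(p_{ni},q_{ni},d_{ni})$, $i=1,2,3$, has determinant $\pm1$. (For $\mu^*$ the integers $p^*_{ni},q^*_{ni},d^*_{ni}$ play the role of $p_{ni},q_{ni},d_{ni}$.) The denominator of the vertex $(p_{ni}/d_{ni},q_{ni}/d_{ni})$ is $d_{ni}$, which is the least common denominator of its coordinates since $\gcd(p_{ni},q_{ni},d_{ni})=1$. A point $x=(x_1,x_2)\in\mathbb R^2$ is a rank 3 point if the subgroup $\mathbb Zx_1+\mathbb Zx_2+\mathbb Z$ of the additive group $\mathbb R$ has rank 3 (equivalently, $x_1,x_2,1$ are linearly independent over $\mathbb Q$). For a triangle $T$, $\operatorname{diam}(T)$ is the length of its longest side; $\operatorname{dist}$ is euclidean distance. *)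

theory Defs
  imports "HOL-Analysis.Analysis"
begin

text \<open>
  A triangle with rational vertices is represented by the integer matrix whose rows are the
  triples (p, q, d) of its vertices (p/d, q/d). For a matrix of determinant 1 or -1 with positive
  last column, each row is determined by its vertex, since the entries of a row are coprime;
  hence such matrices are the same thing as unimodular triangles with numbered vertices.
\<close>

definition denom :: "int^3^3 \<Rightarrow> 3 \<Rightarrow> int" where
  "denom M i = M $ i $ 3"

definition vertex :: "int^3^3 \<Rightarrow> 3 \<Rightarrow> real^2" where
  "vertex M i = vector [of_int (M $ i $ 1) / of_int (denom M i),
                        of_int (M $ i $ 2) / of_int (denom M i)]"

definition triangle :: "int^3^3 \<Rightarrow> (real^2) set" where
  "triangle M = convex hull (range (vertex M))"

definition unimodular_triangle :: "int^3^3 \<Rightarrow> bool" where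
  "unimodular_triangle M \<longleftrightarrow> (\<forall>i. denom M i > 0) \<and> (det M = 1 \<or> det M = -1)"

definition rational_points :: "(real^2) set" where
  "rational_points = {x. x $ 1 \<in> \<rat> \<and> x $ 2 \<in> \<rat>}"

text \<open>The values of \<open>\<mu>\<close> at rational points are irrelevant.\<close>

definition cf_expansion :: "(real^2 \<Rightarrow> nat \<Rightarrow> int^3^3) \<Rightarrow> bool" where
  "cf_expansion \<mu> \<longleftrightarrow>
     (\<forall>x. x \<notin> rational_points \<longrightarrow>
        (\<forall>n. unimodular_triangle (\<mu> x n)) \<and> (\<Inter>n. triangle (\<mu> x n)) = {x})"

text \<open>
  Rank of a finitely generated subgroup of the reals: such a group is a free module over the
  integers, and its rank is the size of a basis.
\<close>

abbreviation int_scale :: "int \<Rightarrow> real \<Rightarrow> real" where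
  "int_scale n r \<equiv> of_int n * r"

definition has_int_rank :: "real set \<Rightarrow> nat \<Rightarrow> bool" where
  "has_int_rank G r \<longleftrightarrow>
     (\<exists>B. finite B \<and> card B = r \<and> \<not> module.dependent int_scale B \<and>
          module.span int_scale B = G)"

definition rank3_point :: "real^2 \<Rightarrow> bool" where
  "rank3_point x \<longleftrightarrow>
     has_int_rank {of_int a * x $ 1 + of_int b * x $ 2 + of_int c | a b c :: int. True} 3"

text \<open>The angle at \<open>b\<close> between the segments from \<open>b\<close> to \<open>a\<close> and to \<open>c\<close>.\<close>

definition angle_at :: "'a::real_inner \<Rightarrow> 'a \<Rightarrow> 'a \<Rightarrow> real" where
  "angle_at b a c = arccos (((a - b) \<bullet> (c - b)) / (norm (a - b) * norm (c - b)))"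

definition longest_side :: "int^3^3 \<Rightarrow> real" where
  "longest_side M = Max {dist (vertex M i) (vertex M j) | i j. i \<noteq> j}"

definition area :: "int^3^3 \<Rightarrow> real" where
  "area M = measure lborel (triangle M)"

definition max_vertex_dist :: "real^2 \<Rightarrow> int^3^3 \<Rightarrow> real" where
  "max_vertex_dist x M = Max (range (\<lambda>i. dist x (vertex M i)))"

definition half_line :: "real^2 \<Rightarrow> (real^3) set" where
  "half_line x = {t *\<^sub>R vector [x $ 1, x $ 2, 1] | t. t \<ge> 0}"

definition real_row :: "int^3^3 \<Rightarrow> 3 \<Rightarrow> real^3" where
  "real_row M i = (\<chi> j. of_int (M $ i $ j))"

end

theory Submission
  imports Defs "HOL-Real_Asymp.Real_Asymp"
begin

text \<open>
  A unimodular triangle has area \<open>1 / (2 d\<^sub>1 d\<^sub>2 d\<^sub>3)\<close>, so once the triangles are nearly equilateral both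
  ratios in (a) are bounded and strong convergence is automatic; limits exist after passing to a
  subsequence, which is harmless because the triangles need not be nested. Small nearly
  equilateral unimodular triangles occur in every open set, so by Baire's theorem the points that
  lie in arbitrarily small ones and on no rational line form a dense set. At the remaining points
  an expansion is obtained by subdividing the cone over a small rational triangle into unimodular
  cones.
\<close>

text \<open>Rational vertices rule out an equilateral triangle, but the required bounds leave slack:
  an isosceles triangle of base 1 and height 4/5 has largest cosine about 0.53 and squared longest
  side 2.5 times its area. It therefore suffices to come close to this shape, which a family of
  unimodular triangles attached to a rational point does. All interior points of such a triangle
  share it, so a dense set of suitable rational points is enough for Baire's theorem, although those
  points are not themselves generic. Strong convergence is a matter of exponents: for area
  \<open>A\<close> the smallest denominator is at most of order \<open>A powr (-1/3)\<close> and the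
  diameter is of order \<open>A powr (1/2)\<close>; their product bounds the distance to the
  half-line and is of order \<open>A powr (1/6)\<close>.\<close>

section \<open>Triangles as sections of cones\<close>

lemma triangle_conv: "triangle M = convex hull {vertex M 1, vertex M 2, vertex M 3}"
  by (simp add: triangle_def UNIV_3)

lemma vertex_components [simp]:
  "vertex M i $ 1 = of_int (M $ i $ 1) / of_int (denom M i)"
  "vertex M i $ 2 = of_int (M $ i $ 2) / of_int (denom M i)"
  by (simp_all add: vertex_def)

lemma vec2_eq_iff: "(x :: 'a ^ 2) = y \<longleftrightarrow> x $ 1 = y $ 1 \<and> x $ 2 = y $ 2"
  by (simp add: vec_eq_iff forall_2)

text \<open>Here \<open>s i\<close> is the barycentric weight of vertex \<open>i\<close> divided by
  \<open>denom M i\<close>. In this form the subdivision can work with lattice vectors instead of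
  fractions.\<close>

lemma triangle_iff_cone:
  assumes "\<And>i. denom M i > 0"
  shows "x \<in> triangle M \<longleftrightarrow>
    (\<exists>s :: 3 \<Rightarrow> real. (\<forall>i. 0 \<le> s i) \<and> (\<Sum>i\<in>UNIV. s i * of_int (M $ i $ 1)) = x $ 1 \<and>
      (\<Sum>i\<in>UNIV. s i * of_int (M $ i $ 2)) = x $ 2 \<and> (\<Sum>i\<in>UNIV. s i * of_int (M $ i $ 3)) = 1)"
    (is "_ \<longleftrightarrow> ?R")
proof
  have d: "real_of_int (denom M i) > 0" for i
    using assms by simp
  show "x \<in> triangle M" if R: ?R
  proof -
    obtain s :: "3 \<Rightarrow> real" where s: "\<And>i. 0 \<le> s i"
      "(\<Sum>i\<in>UNIV. s i * of_int (M $ i $ 1)) = x $ 1"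
      "(\<Sum>i\<in>UNIV. s i * of_int (M $ i $ 2)) = x $ 2"
      "(\<Sum>i\<in>UNIV. s i * of_int (M $ i $ 3)) = 1"
      using R by blast
    let ?u = "\<lambda>i. s i * of_int (denom M i)"
    have "x = ?u 1 *\<^sub>R vertex M 1 + ?u 2 *\<^sub>R vertex M 2 + ?u 3 *\<^sub>R vertex M 3"
      using s(2,3) d[of 1] d[of 2] d[of 3] by (simp add: vec2_eq_iff sum_3)
    moreover have "0 \<le> ?u i" for i
      using s(1) d[of i] by simp
    moreover have "?u 1 + ?u 2 + ?u 3 = 1"
      using s(4) by (simp add: sum_3 denom_def)
    ultimately show ?thesis
      unfolding triangle_conv convex_hull_3 by blast
  qed
  show ?R if x_in: "x \<in> triangle M"
  proof -
    obtain u v w where u: "0 \<le> u" "0 \<le> v" "0 \<le> w" "u + v + w = 1"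
      and x: "x = u *\<^sub>R vertex M 1 + v *\<^sub>R vertex M 2 + w *\<^sub>R vertex M 3"
      using x_in unfolding triangle_conv convex_hull_3 by blast
    define s :: "3 \<Rightarrow> real" where
      "s = (\<lambda>i. (if i = 1 then u else if i = 2 then v else w) / of_int (denom M i))"
    have "0 \<le> s i" for i
      using u d[of i] by (simp add: s_def)
    moreover have "s 1 * M $ 1 $ 3 = u" "s 2 * M $ 2 $ 3 = v" "s 3 * M $ 3 $ 3 = w"
      using d[of 1] d[of 2] d[of 3] by (simp_all add: s_def denom_def)
    ultimately show ?thesis
      using u(4) x by (intro exI[of _ s]) (simp add: sum_3, simp add: s_def)
  qed
qed

lemma vertex_in_triangle: "vertex M i \<in> triangle M"
  by (simp add: triangle_def hull_inc)

lemma triangle_subset: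
  assumes "convex C" "\<And>i. vertex M i \<in> C"
  shows "triangle M \<subseteq> C"
  using assms by (simp add: triangle_def hull_minimal image_subset_iff)

section \<open>Unimodular triangles by subdivision of cones\<close>

lemma of_int_det_3:
  "real_of_int (det (M :: int ^ 3 ^ 3)) = det (\<chi> i j. real_of_int (M $ i $ j))"
  by (simp add: det_3)

text \<open>An integral inverse would make \<open>det M\<close> a unit, so some row \<open>j\<close>
  of the inverse has a non-integral entry. That row holds the coordinates of the \<open>j\<close>th
  unit vector with respect to the rows of \<open>M\<close>; reducing them to fractional parts
  changes the vector only by a lattice vector.\<close>

lemma fractional_lattice_point:
  fixes M :: "int ^ 3 ^ 3"
  assumes "det M \<noteq> 0" "\<bar>det M\<bar> \<noteq> 1"
  obtains t :: "3 \<Rightarrow> real" and i and w :: "int ^ 3" where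
    "\<And>i. 0 \<le> t i" "\<And>i. t i < 1" "t i > 0"
    "\<And>k. of_int (w $ k) = (\<Sum>i\<in>UNIV. t i * of_int (M $ i $ k))"
proof -
  define A :: "real ^ 3 ^ 3" where "A = (\<chi> i j. of_int (M $ i $ j))"
  have detA: "det A = of_int (det M)"
    by (simp add: A_def of_int_det_3)
  then have "invertible A"
    using assms(1) by (simp add: invertible_det_nz)
  then obtain B where B: "A ** B = mat 1" "B ** A = mat 1"
    unfolding invertible_def by blast
  have "\<exists>j i. B $ j $ i \<notin> \<int>"
  proof (rule ccontr)
    assume "\<not> ?thesis"
    then have "\<forall>j i. \<exists>n. B $ j $ i = of_int n"
      by (meson Ints_cases)
    then obtain b where b: "\<And>j i. B $ j $ i = of_int (b j i)"
      by metis
    have "B = (\<chi> i j. of_int ((\<chi> i j. b i j) $ i $ j))"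
      by (simp add: vec_eq_iff b)
    then have "det B = of_int (det (\<chi> i j. b i j))"
      by (metis of_int_det_3)
    moreover have "det A * det B = 1"
      using B(1) by (metis det_I det_mul)
    ultimately have "det M * det (\<chi> i j. b i j) = 1"
      unfolding detA by (metis of_int_eq_1_iff of_int_mult)
    then show False
      using assms(2) by (simp add: zmult_eq_1_iff) linarith
  qed
  then obtain j i where ij: "B $ j $ i \<notin> \<int>"
    by blast
  define w :: "int ^ 3" where "w = (\<chi> k. (if k = j then 1 else 0) - (\<Sum>i\<in>UNIV. \<lfloor>B $ j $ i\<rfloor> * M $ i $ k))"
  show ?thesis
  proof
    show "0 \<le> frac (B $ j $ i)" "frac (B $ j $ i) < 1" for i
      by (simp_all add: frac_lt_1)
    show "frac (B $ j $ i) > 0"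
      using ij by (simp add: frac_gt_0_iff)
    fix k
    have "(\<Sum>i\<in>UNIV. B $ j $ i * of_int (M $ i $ k)) = (B ** A) $ j $ k"
      by (simp add: matrix_matrix_mult_def A_def)
    also have "\<dots> = (if k = j then 1 else 0)"
      by (simp add: B mat_def)
    finally show "of_int (w $ k) = (\<Sum>i\<in>UNIV. frac (B $ j $ i) * of_int (M $ i $ k))"
      by (simp add: w_def frac_def algebra_simps sum_subtractf)
  qed
qed

lemma det_replace_row:
  fixes M :: "int ^ 3 ^ 3" and w :: "int ^ 3"
  assumes "\<And>k. real_of_int (w $ k) = (\<Sum>i\<in>UNIV. t i * of_int (M $ i $ k))"
  shows "real_of_int (det (\<chi> j. if j = i then w else M $ j)) = t i * of_int (det M)"
  using exhaust_3[of i] by (elim disjE) (simp_all add: det_3 assms sum_3 algebra_simps)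

text \<open>
  Desingularisation of the cone over the triangle: star subdivision at a lattice point with
  fractional coordinates strictly decreases the absolute value of the determinant.
\<close>

lemma exists_unimodular_subtriangle:
  assumes "\<And>i. denom M i > 0" "det M \<noteq> 0" "x \<in> triangle M"
  shows "\<exists>M'. unimodular_triangle M' \<and> x \<in> triangle M' \<and> triangle M' \<subseteq> triangle M"
  using assms
proof (induction "nat \<bar>det M\<bar>" arbitrary: M rule: less_induct)
  case less
  show ?case
  proof (cases "\<bar>det M\<bar> = 1")
    case True
    then have "unimodular_triangle M"
      using less.prems(1) by (auto simp: unimodular_triangle_def)
    then show ?thesis
      using less.prems(3) by blast
  next
    case False
    obtain t i0 and w :: "int ^ 3" where t: "\<And>i. 0 \<le> t i" "\<And>i. t i < 1" "t i0 > (0 :: real)"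
      and w: "\<And>k. real_of_int (w $ k) = (\<Sum>i\<in>UNIV. t i * of_int (M $ i $ k))"
      by (rule fractional_lattice_point[OF less.prems(2) False]) blast
    obtain s :: "3 \<Rightarrow> real" where s: "\<And>i. 0 \<le> s i"
      "(\<Sum>i\<in>UNIV. s i * of_int (M $ i $ 1)) = x $ 1"
      "(\<Sum>i\<in>UNIV. s i * of_int (M $ i $ 2)) = x $ 2"
      "(\<Sum>i\<in>UNIV. s i * of_int (M $ i $ 3)) = 1"
      using less.prems(3) unfolding triangle_iff_cone[OF less.prems(1)] by blast
    \<comment> \<open>Subtracting \<open>s i / t i\<close> times \<open>w\<close> from
      \<open>x\<close>, with the smallest such quotient, keeps all other coordinates nonnegative. So
      \<open>x\<close> lies in the subcone in which \<open>w\<close> replaces row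
      \<open>i\<close>.\<close>
    obtain i where i: "t i > 0" "\<And>j. t j > 0 \<Longrightarrow> s i / t i \<le> s j / t j"
      using ex_is_arg_min_if_finite[of "{j. t j > 0}" "\<lambda>j. s j / t j"] t(3)
      by (auto simp: is_arg_min_linorder)
    define M2 where "M2 = (\<chi> j. if j = i then w else M $ j)"
    have "real_of_int (denom M j) > 0" for j
      using less.prems(1) by simp
    \<comment> \<open>Because \<open>t i0 > 0\<close>, the vector \<open>w\<close> has positive
      height and so defines a vertex.\<close>
    then have "(\<Sum>i\<in>UNIV. t i * of_int (M $ i $ 3)) > 0"
      using t by (intro sum_pos2[of _ i0]) (simp_all add: denom_def less_imp_le)
    then have w3: "w $ 3 > 0"
      by (simp flip: w)
    then have denom2: "denom M2 j > 0" for j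
      using less.prems(1) by (simp add: denom_def M2_def)
    \<comment> \<open>The factor \<open>t i\<close> lies strictly between 0 and 1: the new
      determinant is nonzero and smaller in absolute value.\<close>
    have det2: "real_of_int (det M2) = t i * of_int (det M)"
      unfolding M2_def by (rule det_replace_row) (rule w)
    have "det M2 \<noteq> 0"
      using det2 i(1) less.prems(2) by auto
    moreover have "real_of_int \<bar>det M2\<bar> < real_of_int \<bar>det M\<bar>"
      using det2 t(2)[of i] i(1) less.prems(2) by (simp add: abs_mult)
    then have "nat \<bar>det M2\<bar> < nat \<bar>det M\<bar>"
      by linarith
    moreover have "x \<in> triangle M2"
    proof -
      define s' where "s' = (\<lambda>j. if j = i then s i / t i else s j - s i / t i * t j)"
      have "0 \<le> s' j" for j
      proof (cases "t j > 0")
        case True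
        then show ?thesis
          using s(1)[of i] i(1) i(2)[OF True] by (simp add: s'_def field_simps)
      next
        case False
        then have "t j = 0"
          using t(1)[of j] by simp
        then show ?thesis
          using s(1)[of i] s(1)[of j] i(1) by (simp add: s'_def)
      qed
      moreover have "(\<Sum>j\<in>UNIV. s' j * of_int (M2 $ j $ k)) = (\<Sum>j\<in>UNIV. s j * of_int (M $ j $ k))" for k
        using exhaust_3[of i] i(1)
        by (elim disjE) (simp_all add: s'_def M2_def w sum_3 field_simps)
      ultimately show ?thesis
        unfolding triangle_iff_cone[OF denom2] using s by (intro exI[of _ s']) simp
    qed
    moreover have "triangle M2 \<subseteq> triangle M"
    proof (rule triangle_subset)
      show "convex (triangle M)"
        by (simp add: triangle_def)
      show "vertex M2 j \<in> triangle M" for j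
      proof (cases "j = i")
        case True
        have *: "(\<Sum>i\<in>UNIV. t i / of_int (w $ 3) * of_int (M $ i $ k)) = of_int (w $ k) / of_int (w $ 3)" for k
          by (simp add: w sum_divide_distrib)
        show ?thesis
          unfolding triangle_iff_cone[OF less.prems(1)]
          using t(1) w3 by (intro exI[of _ "\<lambda>i. t i / of_int (w $ 3)"], unfold *) (simp add: True M2_def denom_def)
      next
        case False
        then have "vertex M2 j = vertex M j"
          by (simp add: vertex_def denom_def M2_def)
        then show ?thesis
          by (simp add: vertex_in_triangle)
      qed
    qed
    ultimately show ?thesis
      using less.hyps[of M2, OF _ denom2] by blast
  qed
qed

lemma exists_small_unimodular_triangle:
  fixes x :: "real ^ 2"
  assumes "\<epsilon> > 0"
  obtains M where "unimodular_triangle M" "x \<in> triangle M" "triangle M \<subseteq> ball x \<epsilon>"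
proof -
  obtain m :: nat where m: "real m > 4 / \<epsilon>"
    using reals_Archimedean2 by blast
  have m0: "real m > 0"
    using m assms by (smt (verit) divide_pos_pos)
  have m\<epsilon>: "4 / m < \<epsilon>"
    using m assms m0 by (simp add: field_simps)
  define a b where "a = \<lfloor>m * x $ 1\<rfloor>" and "b = \<lfloor>m * x $ 2\<rfloor>"
  have a: "0 \<le> m * x $ 1 - a" "m * x $ 1 - a \<le> 1" and b: "0 \<le> m * x $ 2 - b" "m * x $ 2 - b \<le> 1"
    by (simp_all add: a_def b_def) linarith+
  \<comment> \<open>Legs of length 2 are just enough to cover the unit grid square containing
    \<open>m\<close> times \<open>x\<close>. The triangle is not unimodular; subdivision repairs
    that.\<close>
  define M :: "int ^ 3 ^ 3" where
    "M = vector [vector [a, b, int m], vector [a + 2, b, int m], vector [a, b + 2, int m]]"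
  have M: "denom M i > 0" for i
    using exhaust_3[of i] m0 by (auto simp: M_def denom_def)
  have "det M = 4 * int m"
    by (simp add: M_def det_3 algebra_simps)
  then have "det M \<noteq> 0"
    using m0 by simp
  moreover have "x \<in> triangle M"
  proof -
    define s :: "3 \<Rightarrow> real" where "s = (\<lambda>i. (if i = 1 then 2 - (m * x $ 1 - a) - (m * x $ 2 - b)
      else if i = 2 then m * x $ 1 - a else m * x $ 2 - b) / (2 * m))"
    have "0 \<le> s i" for i
      using a b m0 by (simp add: s_def)
    moreover have sums: "s 1 + s 2 + s 3 = 1 / m"
      and "s 2 = (m * x $ 1 - a) / (2 * m)" "s 3 = (m * x $ 2 - b) / (2 * m)"
      using m0 by (simp_all add: s_def field_simps)
    then have "a * (s 1 + s 2 + s 3) + 2 * s 2 = x $ 1" "b * (s 1 + s 2 + s 3) + 2 * s 3 = x $ 2"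
      using m0 unfolding sums by (simp_all add: field_simps)
    moreover have "m * (s 1 + s 2 + s 3) = 1"
      using m0 unfolding sums by simp
    ultimately show ?thesis
      unfolding triangle_iff_cone[OF M]
      by (intro exI[of _ s]) (simp add: sum_3 M_def algebra_simps)
  qed
  ultimately obtain M' where M': "unimodular_triangle M'" "x \<in> triangle M'" "triangle M' \<subseteq> triangle M"
    using exists_unimodular_subtriangle[OF M] by blast
  have "dist x (vertex M i) < \<epsilon>" for i
  proof -
    have "dist x (vertex M i) \<le> \<bar>(x - vertex M i) $ 1\<bar> + \<bar>(x - vertex M i) $ 2\<bar>"
      unfolding dist_norm using norm_le_l1_cart[of "x - vertex M i"] by (simp add: sum_2)
    also have "\<dots> \<le> 2 / m + 2 / m"
    proof (rule add_mono)
      have "m * (x - vertex M i) $ 1 = m * x $ 1 - of_int (M $ i $ 1)"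
        "m * (x - vertex M i) $ 2 = m * x $ 2 - of_int (M $ i $ 2)"
        using m0 exhaust_3[of i] by (auto simp: M_def denom_def field_simps)
      then have "\<bar>m * (x - vertex M i) $ 1\<bar> \<le> 2" "\<bar>m * (x - vertex M i) $ 2\<bar> \<le> 2"
        using exhaust_3[of i] a b by (auto simp: M_def simp del: vector_minus_component vertex_components)
      then show "\<bar>(x - vertex M i) $ 1\<bar> \<le> 2 / m" "\<bar>(x - vertex M i) $ 2\<bar> \<le> 2 / m"
        using m0 unfolding abs_mult by (simp_all add: field_simps)
    qed
    finally show ?thesis
      using m\<epsilon> by simp
  qed
  then have "triangle M \<subseteq> ball x \<epsilon>"
    by (intro triangle_subset) auto
  then show ?thesis
    using that M' by blast
qed

section \<open>Area and longest side\<close>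

lemma area_conv: "area M = \<bar>(vertex M 3 $ 1 - vertex M 1 $ 1) * (vertex M 2 $ 2 - vertex M 1 $ 2) -
    (vertex M 2 $ 1 - vertex M 1 $ 1) * (vertex M 3 $ 2 - vertex M 1 $ 2)\<bar> / 2"
  unfolding area_def triangle_conv by (subst content_triangle [symmetric]) (simp add: measure_completion)

lemma area_unimodular:
  assumes "unimodular_triangle M"
  shows "area M = 1 / of_int (2 * denom M 1 * denom M 2 * denom M 3)"
proof -
  have d: "real_of_int (denom M i) > 0" for i
    using assms by (simp add: unimodular_triangle_def)
  have "(vertex M 3 $ 1 - vertex M 1 $ 1) * (vertex M 2 $ 2 - vertex M 1 $ 2) -
      (vertex M 2 $ 1 - vertex M 1 $ 1) * (vertex M 3 $ 2 - vertex M 1 $ 2) =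
      - real_of_int (det M) / of_int (denom M 1 * denom M 2 * denom M 3)"
    using d[of 1] d[of 2] d[of 3] by (simp add: field_simps det_3 denom_def)
  then have "area M = \<bar>real_of_int (det M)\<bar> / \<bar>of_int (denom M 1 * denom M 2 * denom M 3)\<bar> / 2"
    unfolding area_conv by (simp add: abs_mult)
  also have "\<bar>real_of_int (det M)\<bar> = 1"
    using assms by (auto simp: unimodular_triangle_def)
  finally show ?thesis
    using d[of 1] d[of 2] d[of 3] by (simp add: abs_mult)
qed

lemma finite_sides: "finite {dist (vertex M i) (vertex M j) | i j. i \<noteq> j}"
  by (rule finite_subset[of _ "(\<lambda>(i, j). dist (vertex M i) (vertex M j)) ` UNIV"]) auto

lemma sides_nonempty: "{dist (vertex M i) (vertex M j) | i j. i \<noteq> j} \<noteq> {}"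
proof -
  have "(1 :: 3) \<noteq> 2"
    by simp
  then show ?thesis
    by blast
qed

lemma longest_side_le_iff: "longest_side M \<le> c \<longleftrightarrow> (\<forall>i j. i \<noteq> j \<longrightarrow> dist (vertex M i) (vertex M j) \<le> c)"
  unfolding longest_side_def Max_le_iff[OF finite_sides sides_nonempty] by blast

lemma longest_side_nonneg: "0 \<le> longest_side M"
proof -
  have "dist (vertex M 1) (vertex M 2) \<le> longest_side M"
    using longest_side_le_iff[of M "longest_side M"] by simp
  then show ?thesis
    using zero_le_dist order.trans by blast
qed

lemma dist_vertices_le: "dist (vertex M i) (vertex M j) \<le> longest_side M"
  using longest_side_le_iff[of M "longest_side M"] longest_side_nonneg[of M] by (cases "i = j") auto

text \<open>Convexity is used twice: a ball around each vertex contains the triangle, hence a ball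
  around any point \<open>z\<close> of the triangle contains all vertices, and with them the
  triangle.\<close>

lemma dist_triangle_le_longest_side:
  assumes "y \<in> triangle M" "z \<in> triangle M"
  shows "dist y z \<le> longest_side M"
proof -
  have "triangle M \<subseteq> cball (vertex M i) (longest_side M)" for i
    by (rule triangle_subset) (auto simp: dist_vertices_le)
  then have "triangle M \<subseteq> cball z (longest_side M)"
    using assms(2) by (intro triangle_subset) (auto simp: subset_iff dist_commute[of z])
  then show ?thesis
    using assms(1) by (auto simp: dist_commute)
qed

text \<open>Crude, but it turns a bound by the area into a bound by the longest side, which tends to
  0.\<close>

lemma area_le_longest_side: "area M \<le> (longest_side M)\<^sup>2"
proof -
  have *: "\<bar>vertex M i $ k - vertex M j $ k\<bar> \<le> longest_side M" for i j k
    using component_le_norm_cart[of "vertex M i - vertex M j" k] dist_vertices_le[of M i j]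
    by (simp add: dist_norm)
  have "\<bar>(vertex M i $ k - vertex M j $ k) * (vertex M i' $ k' - vertex M j' $ k')\<bar> \<le> (longest_side M)\<^sup>2"
    for i j k i' j' k'
    using mult_mono[OF *[of i k j] *[of i' k' j']] longest_side_nonneg[of M]
    by (simp add: abs_mult power2_eq_square)
  from this[of 3 1 1 2 2 1] this[of 2 1 1 3 2 1] abs_triangle_ineq4 show ?thesis
    unfolding area_conv by (smt (verit) field_sum_of_halves)
qed

section \<open>The nearly equilateral shape\<close>

text \<open>
  The constants sit strictly inside the bounds of the theorem: \<open>3/5 < sqrt 13 / 6\<close>, the cosine of
  \<open>arcsin (sqrt 23 / 6)\<close>, and \<open>3 < 4 * sqrt (13 / 23)\<close>.
\<close>

definition fat :: "int^3^3 \<Rightarrow> bool" where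
  "fat M \<longleftrightarrow> (longest_side M)\<^sup>2 \<le> 3 * area M \<and>
    (\<forall>i j k. i \<noteq> j \<and> j \<noteq> k \<and> i \<noteq> k \<longrightarrow>
      (vertex M j - vertex M i) \<bullet> (vertex M k - vertex M i) \<le>
        3 / 5 * (norm (vertex M j - vertex M i) * norm (vertex M k - vertex M i)))"

lemma fat_angle:
  assumes "fat M" "i \<noteq> j" "j \<noteq> k" "i \<noteq> k"
  shows "arcsin (sqrt 23 / 6) < angle_at (vertex M i) (vertex M j) (vertex M k)"
proof -
  let ?a = "vertex M j - vertex M i" and ?b = "vertex M k - vertex M i"
  let ?q = "(?a \<bullet> ?b) / (norm ?a * norm ?b)"
  have s23: "sqrt 23 < 5"
    by (rule real_less_lsqrt) auto
  have s1: "-1 \<le> sqrt 23 / (6 :: real)" "sqrt 23 / 6 \<le> (1 :: real)"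
    using s23 real_sqrt_ge_zero[of 23] by linarith+
  then have "arcsin (sqrt 23 / 6) \<le> pi / 2" "arcsin 0 \<le> arcsin (sqrt 23 / 6)"
    by (metis arcsin_ubound, intro arcsin_le_arcsin) simp_all
  then have "0 \<le> arcsin (sqrt 23 / 6)" "arcsin (sqrt 23 / 6) \<le> pi"
    using pi_gt_zero unfolding arcsin_0 by linarith+
  then have "arcsin (sqrt 23 / 6) = arccos (cos (arcsin (sqrt 23 / 6)))"
    by (simp add: arccos_cos)
  also have "\<dots> = arccos (sqrt (13 / 36))"
    unfolding cos_arcsin[OF s1] by (simp add: power_divide)
  also have "\<dots> < arccos ?q"
  proof (subst arccos_less_mono)
    show "\<bar>sqrt (13 / 36 :: real)\<bar> \<le> 1"
      by simp
    have "\<bar>?a \<bullet> ?b\<bar> \<le> norm ?a * norm ?b"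
      by (rule Cauchy_Schwarz_ineq2)
    then show "\<bar>?q\<bar> \<le> 1"
      by (cases "norm ?a * norm ?b = 0") (simp_all add: abs_mult divide_le_eq_1 less_le del: mult_eq_0_iff)
    have "?q \<le> 3 / 5"
    \<comment> \<open>For coinciding vertices the quotient is 0 by the convention for
      division.\<close>
    proof (cases "norm ?a * norm ?b = 0")
      case False
      then have pos: "norm ?a * norm ?b > 0"
        by simp
      show ?thesis
        using assms unfolding fat_def pos_divide_le_eq[OF pos] by blast
    qed auto
    also have "3 / 5 < sqrt (13 / 36 :: real)"
      by (rule real_less_rsqrt) (simp add: power_divide)
    finally show "?q < sqrt (13 / 36)" .
  qed
  finally show ?thesis
    by (simp add: angle_at_def)
qed

text \<open>Symmetry in the last two arguments leaves one angle inequality per vertex to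
  verify.\<close>

lemma three_distinct_cases:
  fixes P :: "3 \<Rightarrow> 3 \<Rightarrow> 3 \<Rightarrow> bool"
  assumes "\<And>i j k. P i j k \<Longrightarrow> P i k j" "P 1 2 3" "P 2 3 1" "P 3 1 2" "i \<noteq> j" "j \<noteq> k" "i \<noteq> k"
  shows "P i j k"
  using exhaust_3[of i] exhaust_3[of j] exhaust_3[of k] assms by (elim disjE) simp_all

text \<open>For \<open>X = 1/2\<close>, \<open>Y = 4/5\<close>, \<open>s = 1\<close> the base is the
  longest side, the legs are about 0.94 and the area is 2/5. Legs of at least
  \<open>9/10 * s\<close> already give cosines below 3/5, with room for errors of 1/100 in
  \<open>X\<close> and \<open>Y\<close>.\<close>

lemma shape_near_isosceles:
  assumes "vertex M 1 = v + s *\<^sub>R vector [1, 0]" "vertex M 2 = v" "vertex M 3 = v + s *\<^sub>R vector [X, Y]"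
    and s: "s > 0" and XY: "\<bar>X - 1 / 2\<bar> \<le> 1 / 100" "\<bar>Y - 4 / 5\<bar> \<le> 1 / 100"
  shows "fat M" "dist v (vertex M i) \<le> s"
proof -
  have X: "49 / 100 \<le> X" "X \<le> 51 / 100" and Y: "79 / 100 \<le> Y" "Y \<le> 81 / 100"
    using XY by linarith+
  have X2: "(49 / 100)\<^sup>2 \<le> X\<^sup>2" "X\<^sup>2 \<le> (51 / 100)\<^sup>2" "(49 / 100)\<^sup>2 \<le> (1 - X)\<^sup>2" "(1 - X)\<^sup>2 \<le> (51 / 100)\<^sup>2"
    and Y2: "(79 / 100)\<^sup>2 \<le> Y\<^sup>2" "Y\<^sup>2 \<le> (81 / 100)\<^sup>2"
    using X Y by (auto intro!: power_mono)
  note diffs = assms(1-3)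
  have norm2: "norm (vector [a, b] :: real ^ 2) = sqrt (a\<^sup>2 + b\<^sup>2)" for a b
    by (simp add: norm_vec_def L2_set_def sum_2)
  have vdiff: "vertex M 1 - vertex M 2 = s *\<^sub>R vector [1, 0]"
    "vertex M 3 - vertex M 2 = s *\<^sub>R vector [X, Y]" "vertex M 3 - vertex M 1 = s *\<^sub>R vector [X - 1, Y]"
    by (simp_all add: diffs vec2_eq_iff algebra_simps)
  have n12: "norm (vertex M 1 - vertex M 2) = s"
    using s by (simp add: vdiff norm2)
  have "9 / 10 \<le> sqrt (X\<^sup>2 + Y\<^sup>2)" "9 / 10 \<le> sqrt ((X - 1)\<^sup>2 + Y\<^sup>2)"
    by (rule real_le_rsqrt, use X2 Y2 in \<open>simp add: power2_commute[of X 1] power_divide\<close>)+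
  moreover have "sqrt (X\<^sup>2 + Y\<^sup>2) \<le> 1" "sqrt ((X - 1)\<^sup>2 + Y\<^sup>2) \<le> 1"
    by (rule real_le_lsqrt, use X2 Y2 in \<open>simp_all add: power2_commute[of X 1] power_divide\<close>)+
  ultimately have n32: "9 / 10 * s \<le> norm (vertex M 3 - vertex M 2)" "norm (vertex M 3 - vertex M 2) \<le> s"
    and n31: "9 / 10 * s \<le> norm (vertex M 3 - vertex M 1)" "norm (vertex M 3 - vertex M 1) \<le> s"
    using s by (simp_all add: vdiff norm2)
  show "dist v (vertex M i) \<le> s"
    using exhaust_3[of i] n12 n32 s by (auto simp: dist_norm diffs(2)[symmetric] norm_minus_commute simp del: diffs)
  have "longest_side M \<le> s"
    unfolding longest_side_le_iff
    using n12 n32 n31 s by (auto simp: forall_3 dist_norm norm_minus_commute)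
  then have "(longest_side M)\<^sup>2 \<le> s\<^sup>2"
    using longest_side_nonneg by (rule power_mono)
  also have "\<dots> \<le> 3 * (s\<^sup>2 * Y / 2)"
    using s Y by simp
  also have "area M = s\<^sup>2 * Y / 2"
    using s Y unfolding area_conv by (simp add: diffs abs_mult power2_eq_square)
  then have "3 * (s\<^sup>2 * Y / 2) = 3 * area M"
    by linarith
  finally have "(longest_side M)\<^sup>2 \<le> 3 * area M" .
  moreover have "(vertex M j - vertex M i) \<bullet> (vertex M k - vertex M i) \<le>
        3 / 5 * (norm (vertex M j - vertex M i) * norm (vertex M k - vertex M i))"
    if "i \<noteq> j" "j \<noteq> k" "i \<noteq> k" for i j k
    using _ _ _ _ that
  proof (rule three_distinct_cases)
    show "(vertex M k - vertex M i) \<bullet> (vertex M j - vertex M i) \<le>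
        3 / 5 * (norm (vertex M k - vertex M i) * norm (vertex M j - vertex M i))"
      if "(vertex M j - vertex M i) \<bullet> (vertex M k - vertex M i) \<le>
        3 / 5 * (norm (vertex M j - vertex M i) * norm (vertex M k - vertex M i))" for i j k
      using that by (simp add: inner_commute mult.commute)
    have "(vertex M 2 - vertex M 1) \<bullet> (vertex M 3 - vertex M 1) = (1 - X) * (s * s)"
      by (simp add: diffs inner_vec_def sum_2 algebra_simps)
    also have "\<dots> \<le> 3 / 5 * 9 / 10 * (s * s)"
      using X by (intro mult_right_mono) auto
    also have "\<dots> = 3 / 5 * (norm (vertex M 2 - vertex M 1) * (9 / 10 * s))"
      using n12 by (simp add: norm_minus_commute)
    also have "\<dots> \<le> 3 / 5 * (norm (vertex M 2 - vertex M 1) * norm (vertex M 3 - vertex M 1))"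
      using n31 by (intro mult_left_mono) auto
    finally show "(vertex M 2 - vertex M 1) \<bullet> (vertex M 3 - vertex M 1) \<le>
        3 / 5 * (norm (vertex M 2 - vertex M 1) * norm (vertex M 3 - vertex M 1))" .
    have "(vertex M 3 - vertex M 2) \<bullet> (vertex M 1 - vertex M 2) = X * (s * s)"
      by (simp add: diffs inner_vec_def sum_2 algebra_simps)
    also have "\<dots> \<le> 3 / 5 * 9 / 10 * (s * s)"
      using X by (intro mult_right_mono) auto
    also have "\<dots> = 3 / 5 * ((9 / 10 * s) * norm (vertex M 1 - vertex M 2))"
      using n12 by simp
    also have "\<dots> \<le> 3 / 5 * (norm (vertex M 3 - vertex M 2) * norm (vertex M 1 - vertex M 2))"
      using n32 by (intro mult_left_mono mult_right_mono) auto
    finally show "(vertex M 3 - vertex M 2) \<bullet> (vertex M 1 - vertex M 2) \<le>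
        3 / 5 * (norm (vertex M 3 - vertex M 2) * norm (vertex M 1 - vertex M 2))" .
    have "(vertex M 1 - vertex M 3) \<bullet> (vertex M 2 - vertex M 3) = (Y\<^sup>2 - X * (1 - X)) * (s * s)"
      by (simp add: diffs inner_vec_def sum_2 algebra_simps power2_eq_square)
    \<comment> \<open>Completing the square shows that near 1/2 this product varies only to second
      order.\<close>
    also have "X * (1 - X) = 1 / 4 - (X - 1 / 2)\<^sup>2"
      by (simp add: power2_eq_square algebra_simps)
    also have "(Y\<^sup>2 - (1 / 4 - (X - 1 / 2)\<^sup>2)) * (s * s) \<le> (3 / 5 * (9 / 10 * (9 / 10))) * (s * s)"
    proof (rule mult_right_mono)
      have "(X - 1 / 2)\<^sup>2 \<le> (1 / 100)\<^sup>2"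
        using XY by (intro power2_le_iff_abs_le[THEN iffD2]) auto
      then show "Y\<^sup>2 - (1 / 4 - (X - 1 / 2)\<^sup>2) \<le> 3 / 5 * (9 / 10 * (9 / 10))"
        using Y2 by (simp add: power2_eq_square)
    qed simp
    also have "\<dots> = 3 / 5 * ((9 / 10 * s) * (9 / 10 * s))"
      by simp
    also have "\<dots> \<le> 3 / 5 * (norm (vertex M 1 - vertex M 3) * norm (vertex M 2 - vertex M 3))"
      using n31 n32 s by (intro mult_left_mono mult_mono) (auto simp: norm_minus_commute)
    finally show "(vertex M 1 - vertex M 3) \<bullet> (vertex M 2 - vertex M 3) \<le>
        3 / 5 * (norm (vertex M 1 - vertex M 3) * norm (vertex M 2 - vertex M 3))" .
  qed
  ultimately show "fat M"
    unfolding fat_def by blast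
qed

section \<open>Nearly equilateral unimodular triangles in every ball\<close>

text \<open>
  Let \<open>P = (p, q, N)\<close>, \<open>Q = (1, 0, 0)\<close>, \<open>R = (0, b, c)\<close>, a basis of the integer lattice. The triangle has
  rows \<open>k P + Q\<close>, \<open>(k + 1) P + Q\<close>, \<open>R + a P + 10 n Q\<close>. Seen from the point \<open>P\<close> in units of
  \<open>1 / (N k (k + 1))\<close>, its first two vertices are \<open>(k + 1, 0)\<close> and \<open>(k, 0)\<close>, and \<open>k\<close> and \<open>a\<close> (linear and
  quadratic in \<open>n\<close>) are chosen so that the third one is \<open>(k + X, Y)\<close> with
  \<open>(X, Y)\<close> tending to \<open>(1/2, 4/5)\<close>: an isosceles triangle that is nearly equilateral.
\<close>

lemma exists_fat_triangle_near_point: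
  fixes p q N b c :: int
  assumes N: "N > 0" and bez: "N * b - q * c = 1"
  obtains M where "unimodular_triangle M" "fat M"
    "\<And>i. dist (vector [of_int p / of_int N, of_int q / of_int N]) (vertex M i) \<le> 1 / of_int N"
proof -
  \<comment> \<open>By the Bezout relation \<open>N R = c P + (\<omega>, 1, 0)\<close>: relative to
    \<open>P\<close>, the vector \<open>R\<close> has horizontal offset \<open>\<omega>\<close> and
    vertical offset 1.\<close>
  define \<omega> where "\<omega> = - (p * c)"
  define k :: "nat \<Rightarrow> int" where "k n = 8 * N * int n" for n
  \<comment> \<open>The coefficients are chosen so that \<open>(k n + 1) * (10 * N * n + \<omega>) -
    d n = 5 * N * n + \<omega> - c\<close>: the quadratic terms cancel since 80 = 8 * 10, and
    \<open>8 * \<omega> * n\<close> cancels the linear term in \<open>\<omega>\<close>. Hence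
    \<open>X\<close> tends to 8 * 5 / 80 and \<open>Y\<close> to 8 * 8 / 80.\<close>
  define a where "a n = 80 * N * int n * int n + 5 * int n + 8 * \<omega> * int n" for n
  define d where "d n = a n * N + c" for n
  define X :: "nat \<Rightarrow> real" where
    "X n = k n * (k n + 1) * (10 * N * int n + \<omega>) / d n - k n" for n
  define Y :: "nat \<Rightarrow> real" where "Y n = k n * (k n + 1) / d n" for n
  define N' c' w' :: real where N'_def: "N' = N" and c'_def: "c' = c" and w'_def: "w' = \<omega>"
  have N': "N' > 0"
    using N by (simp add: N'_def)
  have d_eq: "real_of_int (d n) = 80 * N'\<^sup>2 * real n ^ 2 + (5 + 8 * w') * N' * real n + c'" for n
    by (simp add: d_def a_def N'_def c'_def w'_def algebra_simps power2_eq_square)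
  have "filterlim (\<lambda>n. 80 * N'\<^sup>2 * real n ^ 2 + (5 + 8 * w') * N' * real n + c') at_top at_top"
    using N' by real_asymp
  then have d_pos: "\<forall>\<^sub>F n in at_top. real_of_int (d n) > 0"
    unfolding d_eq filterlim_at_top_dense by blast
  have "Y \<longlonglongrightarrow> 4 / 5"
  proof -
    have "(\<lambda>n. 8 * N' * real n * (8 * N' * real n + 1) /
        (80 * N'\<^sup>2 * real n ^ 2 + (5 + 8 * w') * N' * real n + c')) \<longlonglongrightarrow> 4 / 5"
      using N' by (real_asymp simp: power2_eq_square) (simp add: field_simps)
    then show ?thesis
      unfolding Y_def d_eq by (simp add: k_def N'_def)
  qed
  then have evY: "\<forall>\<^sub>F n in at_top. \<bar>Y n - 4 / 5\<bar> < 1 / 100"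
    using tendstoD[of Y "4 / 5" sequentially "1 / 100"] by (simp add: dist_real_def)
  have "X \<longlonglongrightarrow> 1 / 2"
  proof -
    have "(\<lambda>n. 8 * N' * real n * (5 * N' * real n + w' - c') /
        (80 * N'\<^sup>2 * real n ^ 2 + (5 + 8 * w') * N' * real n + c')) \<longlonglongrightarrow> 1 / 2"
      using N' by (real_asymp simp: power2_eq_square) (simp add: field_simps)
    moreover have "\<forall>\<^sub>F n in at_top. 8 * N' * real n * (5 * N' * real n + w' - c') /
        (80 * N'\<^sup>2 * real n ^ 2 + (5 + 8 * w') * N' * real n + c') = X n"
      using d_pos
    proof eventually_elim
      case (elim n)
      have "8 * N' * real n * (5 * N' * real n + w' - c') =
        k n * (k n + 1) * (10 * N * int n + \<omega>) - k n * d n"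
        by (simp add: k_def d_def a_def N'_def c'_def w'_def algebra_simps power2_eq_square)
      then show ?case
        using elim by (simp add: X_def diff_divide_distrib flip: d_eq)
    qed
    ultimately show ?thesis
      by (rule Lim_transform_eventually)
  qed
  then have evX: "\<forall>\<^sub>F n in at_top. \<bar>X n - 1 / 2\<bar> < 1 / 100"
    using tendstoD[of X "1 / 2" sequentially "1 / 100"] by (simp add: dist_real_def)
  obtain n where n: "n > 0" "real_of_int (d n) > 0" "\<bar>X n - 1 / 2\<bar> < 1 / 100" "\<bar>Y n - 4 / 5\<bar> < 1 / 100"
    using eventually_happens[OF eventually_conj[OF eventually_gt_at_top[of 0]
      eventually_conj[OF d_pos eventually_conj[OF evX evY]]]] by auto
  have k: "k n \<ge> 1"
    using n(1) N by (simp add: k_def) (smt (verit) mult_pos_pos of_nat_0_less_iff)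
  define s where "s = 1 / (real_of_int N * of_int (k n) * (of_int (k n) + 1))"
  define M :: "int ^ 3 ^ 3" where "M = vector [
    vector [k n * p + 1, k n * q, k n * N],
    vector [(k n + 1) * p + 1, (k n + 1) * q, (k n + 1) * N],
    vector [a n * p + 10 * int n, a n * q + b, d n]]"
  define P :: "real ^ 2" where "P = vector [of_int p / of_int N, of_int q / of_int N]"
  define v where "v = P + vector [s * of_int (k n), 0]"
  have d0: "d n > 0"
    using n(2) by simp
  have den: "denom M 1 = k n * N" "denom M 2 = (k n + 1) * N" "denom M 3 = d n"
    by (simp_all add: M_def denom_def)
  \<comment> \<open>Row operations reduce the rows to \<open>Q\<close>, \<open>P\<close>,
    \<open>R\<close>, so \<open>n\<close> drops out.\<close>
  have "det M = q * c - N * b"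
    by (simp add: M_def det_3 d_def algebra_simps)
  then have uni: "unimodular_triangle M"
    using bez den N k d0 by (simp add: unimodular_triangle_def forall_3)
  have s: "s > 0"
    using N k by (simp add: s_def)
  have k1: "real_of_int (k n) + 1 \<noteq> 0"
    using k by linarith
  have v1: "vertex M 1 = v + s *\<^sub>R vector [1, 0]"
  proof -
    have "s * (of_int (k n) + 1) = 1 / (N * k n)"
      using k1 by (simp add: s_def)
    then have "s * k n + s = 1 / (N * k n)"
      by (simp add: algebra_simps)
    then show ?thesis
      using N k by (simp add: vec2_eq_iff den, simp add: M_def v_def P_def add_divide_distrib)
  qed
  have v2: "vertex M 2 = v"
  proof -
    have "s * k n = 1 / (N * (of_int (k n) + 1))"
      using k by (simp add: s_def)
    moreover have "((of_int (k n) + 1) * real_of_int p + 1) / ((of_int (k n) + 1) * N) =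
        p / N + 1 / (N * (of_int (k n) + 1))"
      using k1 N unfolding add_divide_distrib by simp
    ultimately show ?thesis
      using k1 N by (simp add: vec2_eq_iff den, simp add: M_def v_def P_def)
  qed
  have v3: "vertex M 3 = v + s *\<^sub>R vector [X n, Y n]"
  proof -
    have split_fraction: "A / D = P / N + W / (N * D)" if "A * N = D * P + W" "N \<noteq> 0" "D \<noteq> 0"
      for A D P N W :: real
    proof -
      have "A / D = (A * N) / (N * D)"
        using that(2,3) by simp
      then show ?thesis
        using that(2,3) unfolding that(1) add_divide_distrib by simp
    qed
    have "(a n * p + 10 * int n) * N = d n * p + (10 * N * int n + \<omega>)" "(a n * q + b) * N = d n * q + 1"
      using bez by (simp_all add: d_def \<omega>_def algebra_simps)
    then have "real_of_int (a n * p + 10 * int n) * N = d n * p + (10 * N * int n + \<omega>)"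
      "real_of_int (a n * q + b) * N = d n * q + 1"
      by (metis of_int_add of_int_mult of_int_1)+
    then have "real_of_int (a n * p + 10 * int n) / d n = p / N + (10 * N * int n + \<omega>) / (N * d n)"
      "real_of_int (a n * q + b) / d n = q / N + 1 / (N * d n)"
      using split_fraction N n(2) by simp_all
    moreover have "s * k n + s * X n = (10 * N * int n + \<omega>) / (N * d n)" "s * Y n = 1 / (N * d n)"
      using N k n(2) by (simp_all add: s_def X_def Y_def divide_simps)
    ultimately show ?thesis
      by (simp add: vec2_eq_iff den, simp add: M_def v_def P_def)
  qed
  have shape: "fat M" "dist v (vertex M i) \<le> s" for i
    using shape_near_isosceles[OF v1 v2 v3 s] n by (simp_all add: less_imp_le)
  have "dist P (vertex M i) \<le> 1 / N" for i
  proof -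
    have "dist P (vertex M i) \<le> dist P v + dist v (vertex M i)"
      by (rule dist_triangle)
    also have "dist P v = s * k n"
      using s k by (simp add: v_def dist_norm norm_vec_def L2_set_def sum_2)
    also have "s * k n + dist v (vertex M i) \<le> s * k n + s"
      using shape(2) by simp
    also have "\<dots> = s * (of_int (k n) + 1)"
      by (simp add: algebra_simps)
    also have "s * (of_int (k n) + 1) = 1 / (N * k n)"
      using k1 by (simp add: s_def)
    also have "\<dots> \<le> 1 / N"
      using N k by (simp add: field_simps)
    finally show ?thesis .
  qed
  then show ?thesis
    using that uni shape(1) unfolding P_def by blast
qed

lemma exists_fat_unimodular_triangle:
  fixes y :: "real ^ 2"
  assumes "\<epsilon> > 0"
  obtains M where "unimodular_triangle M" "fat M" "triangle M \<subseteq> ball y \<epsilon>"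
proof -
  obtain m where m: "real 2 ^ m > 3 / \<epsilon>"
    using real_arch_pow[of "real 2" "3 / \<epsilon>"] by auto
  \<comment> \<open>A power of two is coprime to every odd \<open>q\<close>, which provides the
    Bezout relation. Rounding to an odd integer still costs at most 1, and \<open>p\<close> is
    arbitrary.\<close>
  define N :: int where "N = 2 ^ m"
  define p where "p = \<lfloor>N * y $ 1\<rfloor>"
  define q where "q = 2 * \<lfloor>N * y $ 2 / 2\<rfloor> + 1"
  have N: "N > 0"
    by (simp add: N_def)
  have "coprime N q"
    by (simp add: N_def q_def)
  then obtain u t where "u * N + t * q = 1"
    using bezout_int[of N q] by (auto simp: coprime_iff_gcd_eq_1)
  then have "N * u - q * (- t) = 1"
    by (simp add: algebra_simps)
  from exists_fat_triangle_near_point[OF N this, of p] obtain M where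
    M: "unimodular_triangle M" "fat M"
      "\<And>i. dist (vector [of_int p / of_int N, of_int q / of_int N]) (vertex M i) \<le> 1 / of_int N"
    by blast
  have "dist y (vertex M i) < \<epsilon>" for i
  proof -
    let ?P = "vector [of_int p / of_int N, of_int q / of_int N] :: real ^ 2"
    have "dist y ?P \<le> \<bar>(y - ?P) $ 1\<bar> + \<bar>(y - ?P) $ 2\<bar>"
      unfolding dist_norm using norm_le_l1_cart[of "y - ?P"] by (simp add: sum_2)
    also have "\<dots> \<le> 1 / N + 1 / N"
    proof (rule add_mono)
      have "\<bar>N * y $ 1 - p\<bar> \<le> 1" "\<bar>N * y $ 2 - q\<bar> \<le> 1"
        unfolding p_def q_def by linarith+
      moreover have "N * y $ 1 - p = N * (y - ?P) $ 1" "N * y $ 2 - q = N * (y - ?P) $ 2"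
        using N by (simp_all add: field_simps)
      ultimately have "\<bar>N * (y - ?P) $ 1\<bar> \<le> 1" "\<bar>N * (y - ?P) $ 2\<bar> \<le> 1"
        by (simp_all only:)
      then show "\<bar>(y - ?P) $ 1\<bar> \<le> 1 / N" "\<bar>(y - ?P) $ 2\<bar> \<le> 1 / N"
        using N unfolding abs_mult by (simp_all add: field_simps)
    qed
    finally have "dist y (vertex M i) \<le> 3 / N"
      using M(3)[of i] dist_triangle[of y "vertex M i" ?P] by simp
    also have "3 / N < \<epsilon>"
      using m assms by (simp add: N_def field_simps)
    finally show ?thesis .
  qed
  then have "triangle M \<subseteq> ball y \<epsilon>"
    by (intro triangle_subset) auto
  then show ?thesis
    using that M by blast
qed

section \<open>Bounded ratios and distance to the half-line\<close>

lemma area_pos: "unimodular_triangle M \<Longrightarrow> area M > 0"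
  by (simp add: area_unimodular unimodular_triangle_def)

lemma fat_ratio_le:
  assumes "unimodular_triangle M" "fat M"
  shows "longest_side M / sqrt (area M) \<le> sqrt 3"
proof -
  have "longest_side M \<le> sqrt (3 * area M)"
    using assms(2) by (intro real_le_rsqrt) (simp add: fat_def)
  then show ?thesis
    using area_pos[OF assms(1)] by (simp add: real_sqrt_mult pos_divide_le_eq)
qed

lemma max_vertex_dist_le:
  assumes "x \<in> triangle M"
  shows "max_vertex_dist x M \<le> longest_side M" "0 \<le> max_vertex_dist x M"
proof -
  show "max_vertex_dist x M \<le> longest_side M"
    unfolding max_vertex_dist_def
    using dist_triangle_le_longest_side[OF assms vertex_in_triangle] by (subst Max_le_iff) auto
  have "dist x (vertex M 1) \<le> max_vertex_dist x M"
    unfolding max_vertex_dist_def by (rule Max_ge) auto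
  then show "0 \<le> max_vertex_dist x M"
    using zero_le_dist order.trans by blast
qed

text \<open>The comparison point on the half-line is the one at the same height
  \<open>denom M i\<close>, so the difference is horizontal and scaled by that height.\<close>

lemma infdist_half_line_le:
  assumes "denom M i > 0"
  shows "infdist (real_row M i) (half_line x) \<le> of_int (denom M i) * dist (vertex M i) x"
proof -
  let ?d = "real_of_int (denom M i)"
  have d: "?d > 0"
    using assms by simp
  have "?d *\<^sub>R vector [x $ 1, x $ 2, 1] \<in> half_line x"
    unfolding half_line_def using d by (auto intro!: exI[of _ ?d])
  then have "infdist (real_row M i) (half_line x) \<le> dist (real_row M i) (?d *\<^sub>R vector [x $ 1, x $ 2, 1])"
    by (rule infdist_le)
  also have "real_row M i - ?d *\<^sub>R vector [x $ 1, x $ 2, 1] =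
      ?d *\<^sub>R vector [(vertex M i - x) $ 1, (vertex M i - x) $ 2, 0]"
    using d by (simp add: vec_eq_iff forall_3 real_row_def algebra_simps) (simp add: denom_def)
  then have "dist (real_row M i) (?d *\<^sub>R vector [x $ 1, x $ 2, 1]) =
      ?d * norm (vector [(vertex M i - x) $ 1, (vertex M i - x) $ 2, 0] :: real ^ 3)"
    using d by (simp only: dist_norm norm_scaleR abs_of_pos)
  also have "norm (vector [(vertex M i - x) $ 1, (vertex M i - x) $ 2, 0] :: real ^ 3) = dist (vertex M i) x"
    unfolding dist_norm by (simp add: norm_vec_def L2_set_def sum_2 sum_3)
  finally show ?thesis .
qed

text \<open>
  If \<open>d\<close> is the smallest denominator, then \<open>d ^ 3\<close> is at most the product of the denominators, that is
  \<open>1 / (2 * area M)\<close>, while fatness bounds the diameter by a multiple of \<open>sqrt (area M)\<close>.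
\<close>

lemma infdist_half_line_bound:
  assumes M: "unimodular_triangle M" "fat M" and x: "x \<in> triangle M"
    and min: "\<And>i. denom M v \<le> denom M i"
  shows "infdist (real_row M v) (half_line x) ^ 6 \<le> 7 * (longest_side M)\<^sup>2"
proof -
  let ?d = "real_of_int (denom M v)"
  have d: "?d > 0"
    using M(1) by (simp add: unimodular_triangle_def)
  have a: "area M > 0"
    using M(1) by (rule area_pos)
  have "?d * ?d * ?d \<le> of_int (denom M 1) * of_int (denom M 2) * of_int (denom M 3)"
    using M(1) min by (intro mult_mono mult_nonneg_nonneg) (auto simp: unimodular_triangle_def less_imp_le)
  then have "?d ^ 3 \<le> 1 / (2 * area M)"
    by (simp add: area_unimodular[OF M(1)] power3_eq_cube)
  \<comment> \<open>The sixth power clears both exponents, 1/3 for the denominator and 1/2 for the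
    side: the factors become multiples of \<open>1 / (area M)\<^sup>2\<close> and
    \<open>(area M) ^ 3\<close>.\<close>
  then have "(?d ^ 3)\<^sup>2 \<le> (1 / (2 * area M))\<^sup>2"
    using d by (intro power_mono) simp_all
  then have d6: "?d ^ 6 \<le> 1 / (4 * (area M)\<^sup>2)"
    by (simp add: power_divide power_mult_distrib flip: power_mult)
  have "infdist (real_row M v) (half_line x) \<le> ?d * dist (vertex M v) x"
    using d by (intro infdist_half_line_le) simp
  also have "\<dots> \<le> ?d * longest_side M"
    using d x by (intro mult_left_mono dist_triangle_le_longest_side vertex_in_triangle) auto
  finally have "infdist (real_row M v) (half_line x) ^ 6 \<le> (?d * longest_side M) ^ 6"
    by (intro power_mono infdist_nonneg)
  also have "\<dots> = ?d ^ 6 * ((longest_side M)\<^sup>2) ^ 3"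
    by (simp add: power_mult_distrib flip: power_mult)
  also have "\<dots> \<le> 1 / (4 * (area M)\<^sup>2) * (3 * area M) ^ 3"
    using d6 M(2) by (intro mult_mono power_mono) (auto simp: fat_def)
  also have "\<dots> = 27 / 4 * area M"
    using a by (simp add: power2_eq_square power3_eq_cube)
  also have "\<dots> \<le> 7 * (longest_side M)\<^sup>2"
    using area_le_longest_side[of M] zero_le_power2[of "longest_side M"] by linarith
  finally show ?thesis .
qed

section \<open>A dense set of generic rank 3 points\<close>

lemma rank3_pointI:
  assumes indep: "\<And>a b c :: int. of_int a * x $ 1 + of_int b * x $ 2 + of_int c = 0 \<Longrightarrow> a = 0 \<and> b = 0 \<and> c = 0"
  shows "rank3_point x"
proof -
  interpret Z: module int_scale
    by unfold_locales (simp_all add: algebra_simps)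
  let ?B = "{x $ 1, x $ 2, 1}"
  \<comment> \<open>As \<open>?B\<close> is a set, its elements must be distinct for it to have size
    3 and for coefficients to be assigned to them separately.\<close>
  have ne: "x $ 1 \<noteq> x $ 2" "x $ 1 \<noteq> 1" "x $ 2 \<noteq> 1"
    using indep[of 1 "-1" 0] indep[of 1 0 "-1"] indep[of 0 1 "-1"] by auto
  have sum_B: "(\<Sum>v\<in>?B. of_int (u v) * v) = of_int (u (x $ 1)) * x $ 1 + of_int (u (x $ 2)) * x $ 2 + of_int (u 1)"
    for u :: "real \<Rightarrow> int"
    using ne by simp
  have "Z.independent ?B"
    unfolding Z.dependent_finite[OF finite.insertI[OF finite.insertI[OF finite.insertI[OF finite.emptyI]]]] sum_B
    using indep by blast
  moreover have "Z.span ?B = {of_int a * x $ 1 + of_int b * x $ 2 + of_int c | a b c :: int. True}"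
  proof -
    have "Z.span ?B = range (\<lambda>u. of_int (u (x $ 1)) * x $ 1 + of_int (u (x $ 2)) * x $ 2 + of_int (u 1))"
      by (subst Z.span_finite) (simp_all only: sum_B finite.intros)
    also have "\<dots> = {of_int a * x $ 1 + of_int b * x $ 2 + of_int c | a b c :: int. True}" (is "?L = ?R")
    proof
      show "?L \<subseteq> ?R"
        by blast
      show "?R \<subseteq> ?L"
      proof
        fix y assume "y \<in> ?R"
        then obtain a b c :: int where y: "y = of_int a * x $ 1 + of_int b * x $ 2 + of_int c"
          by blast
        show "y \<in> ?L"
          using ne by (intro range_eqI[of _ _ "\<lambda>r. if r = x $ 1 then a else if r = x $ 2 then b else c"]) (simp add: y)
      qed
    qed
    finally show ?thesis .
  qed
  moreover have "card ?B = 3"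
    using ne by simp
  ultimately show ?thesis
    unfolding rank3_point_def has_int_rank_def by (intro exI[of _ ?B]) simp
qed

text \<open>Interiors make the set open, as Baire's theorem needs; the bound
  \<open>1 / Suc k\<close> makes the triangles found for successive \<open>k\<close> shrink.\<close>

definition fat_cover :: "nat \<Rightarrow> (real ^ 2) set" where
  "fat_cover k = (\<Union>M\<in>{M. unimodular_triangle M \<and> fat M \<and> longest_side M < 1 / Suc k}. interior (triangle M))"

lemma open_fat_cover: "open (fat_cover k)"
  by (auto simp: fat_cover_def)

lemma longest_side_le_ball:
  assumes "triangle M \<subseteq> ball y r"
  shows "longest_side M \<le> 2 * r"
  unfolding longest_side_le_iff
proof (intro allI impI)
  fix i j
  have "dist y (vertex M i) < r" "dist y (vertex M j) < r"
    using assms vertex_in_triangle[of M] by (auto simp: subset_iff)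
  then show "dist (vertex M i) (vertex M j) \<le> 2 * r"
    using dist_triangle3[of "vertex M i" "vertex M j" y] by simp
qed

text \<open>A convex set with empty interior is negligible, which contradicts positive area.\<close>

lemma interior_triangle_nonempty:
  assumes "unimodular_triangle M"
  shows "interior (triangle M) \<noteq> {}"
proof
  assume "interior (triangle M) = {}"
  then have "negligible (triangle M)"
    by (subst negligible_convex_interior) (simp_all add: triangle_def)
  then have "measure lebesgue (triangle M) = 0"
    by (rule negligible_imp_measure0)
  moreover have "triangle M \<in> sets lborel"
    unfolding triangle_conv by (simp add: compact_imp_closed compact_convex_hull finite_imp_compact)
  ultimately show False
    using area_pos[OF assms] by (simp add: area_def measure_completion)
qed

lemma closure_fat_cover: "closure (fat_cover k) = UNIV"
proof -
  have "\<exists>z\<in>fat_cover k. dist z y < e" if "e > 0" for y :: "real ^ 2" and e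
  proof -
    \<comment> \<open>The factor 3 keeps the diameter \<open>2 / (3 * Suc k)\<close> strictly below
      \<open>1 / Suc k\<close>.\<close>
    let ?r = "min e (1 / (3 * Suc k))"
    obtain M where M: "unimodular_triangle M" "fat M" "triangle M \<subseteq> ball y ?r"
      by (rule exists_fat_unimodular_triangle[of ?r y]) (simp_all add: \<open>e > 0\<close>)
    have "longest_side M \<le> 2 * (1 / (3 * Suc k))"
      using longest_side_le_ball[OF M(3)] by linarith
    also have "\<dots> < 1 / Suc k"
      by (simp add: field_simps)
    finally have "interior (triangle M) \<subseteq> fat_cover k"
      using M by (auto simp: fat_cover_def)
    moreover obtain z where z: "z \<in> interior (triangle M)"
      using interior_triangle_nonempty[OF M(1)] by blast
    moreover have "dist z y < e"
      using z M(3) interior_subset by (force simp: dist_commute)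
    ultimately show ?thesis
      by blast
  qed
  then show ?thesis
    by (auto simp: closure_approachable)
qed

definition off_line :: "int \<times> int \<times> int \<Rightarrow> (real ^ 2) set" where
  "off_line = (\<lambda>(a, b, c). {x. of_int a * x $ 1 + of_int b * x $ 2 + of_int c \<noteq> 0})"

lemma open_off_line: "open (off_line l)"
  by (cases l) (auto simp: off_line_def intro!: open_Collect_neq continuous_intros)

lemma closure_off_line:
  assumes "l \<noteq> (0, 0, 0)"
  shows "closure (off_line l) = UNIV"
proof (cases l)
  case (fields a b c)
  show ?thesis
  \<comment> \<open>With \<open>a = b = 0\<close> the constant \<open>c\<close> is nonzero and there
    is no line to remove: the set is the whole plane.\<close>
  proof (cases "a = 0 \<and> b = 0")
    case True
    then show ?thesis
      using assms by (simp add: fields off_line_def)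
  next
    case False
    let ?n = "vector [of_int a, of_int b] :: real ^ 2"
    have "off_line l = - {x. ?n \<bullet> x = - of_int c}"
      by (auto simp: fields off_line_def inner_vec_def sum_2)
    moreover have "?n \<noteq> 0"
      using False by (simp add: vec2_eq_iff)
    ultimately show ?thesis
      by (simp add: closure_complement interior_hyperplane)
  qed
qed

text \<open>The zero triple is left out because its \<open>off_line\<close> set is empty.\<close>

definition generic_points :: "(real ^ 2) set" where
  "generic_points = \<Inter>(range fat_cover \<union> off_line ` (- {(0, 0, 0)}))"

lemma closure_generic_points: "closure generic_points = UNIV"
proof -
  have "UNIV \<subseteq> closure generic_points"
    unfolding generic_points_def
  proof (rule Baire)
    fix T assume "T \<in> range fat_cover \<union> off_line ` (- {(0, 0, 0)})"
    then show "openin (top_of_set UNIV) T \<and> UNIV \<subseteq> closure T"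
      using closure_off_line by (auto simp: open_fat_cover closure_fat_cover open_off_line)
  qed simp_all
  then show ?thesis
    by blast
qed

lemma rank3_generic: "x \<in> generic_points \<Longrightarrow> rank3_point x"
proof (rule rank3_pointI)
  fix a b c :: int
  assume "x \<in> generic_points" and eq: "of_int a * x $ 1 + of_int b * x $ 2 + of_int c = 0"
  then have "\<forall>l \<noteq> (0, 0, 0). x \<in> off_line l"
    by (simp add: generic_points_def)
  moreover have "x \<notin> off_line (a, b, c)"
    using eq by (simp add: off_line_def)
  ultimately have "(a, b, c) = (0, 0, 0)"
    by blast
  then show "a = 0 \<and> b = 0 \<and> c = 0"
    by simp
qed

section \<open>Expansions and convergence of the ratios\<close>

text \<open>A longest side tending to 0 survives passing to a subsequence, which an intersection
  equal to \<open>{x}\<close> need not do without nesting; for triangles containing \<open>x\<close>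
  it implies that intersection.\<close>

definition expands :: "real ^ 2 \<Rightarrow> (nat \<Rightarrow> int ^ 3 ^ 3) \<Rightarrow> bool" where
  "expands x E \<longleftrightarrow> (\<forall>n. unimodular_triangle (E n) \<and> x \<in> triangle (E n)) \<and>
    (\<lambda>n. longest_side (E n)) \<longlonglongrightarrow> 0"

lemma longest_side_tendsto_0:
  assumes "\<And>n. longest_side (E n) \<le> c / Suc n"
  shows "(\<lambda>n. longest_side (E n)) \<longlonglongrightarrow> 0"
proof (rule tendsto_sandwich[OF always_eventually always_eventually tendsto_const])
  show "(\<lambda>n. c / Suc n) \<longlonglongrightarrow> 0"
    by real_asymp
qed (use assms longest_side_nonneg in auto)

lemma exists_expands: "\<exists>E. expands x E"
proof -
  have "\<exists>M. unimodular_triangle M \<and> x \<in> triangle M \<and> longest_side M \<le> 2 / Suc n" for n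
  proof -
    obtain M where "unimodular_triangle M" "x \<in> triangle M" "triangle M \<subseteq> ball x (1 / Suc n)"
      by (rule exists_small_unimodular_triangle[of "1 / Suc n" x]) simp_all
    then show ?thesis
      using longest_side_le_ball by force
  qed
  then obtain E where "\<And>n. unimodular_triangle (E n) \<and> x \<in> triangle (E n) \<and> longest_side (E n) \<le> 2 / Suc n"
    by metis
  then show ?thesis
    using longest_side_tendsto_0[of E 2] by (auto simp: expands_def)
qed

lemma exists_fat_expands:
  assumes "x \<in> generic_points"
  obtains E L L' where "expands x E" "\<And>n. fat (E n)"
    "(\<lambda>n. max_vertex_dist x (E n) / sqrt (area (E n))) \<longlonglongrightarrow> L"
    "(\<lambda>n. longest_side (E n) / sqrt (area (E n))) \<longlonglongrightarrow> L'"
proof -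
  have "\<forall>n. \<exists>M. unimodular_triangle M \<and> fat M \<and> x \<in> triangle M \<and> longest_side M \<le> 1 / Suc n"
  proof
    fix n
    have "x \<in> fat_cover n"
      using assms by (simp add: generic_points_def)
    then obtain M where "unimodular_triangle M" "fat M" "x \<in> interior (triangle M)" "longest_side M < 1 / Suc n"
      unfolding fat_cover_def by blast
    moreover from this have "x \<in> triangle M"
      using interior_subset by blast
    ultimately show "\<exists>M. unimodular_triangle M \<and> fat M \<and> x \<in> triangle M \<and> longest_side M \<le> 1 / Suc n"
      by (intro exI[of _ M]) simp
  qed
  from choice[OF this] obtain E where E: "\<And>n. unimodular_triangle (E n)" "\<And>n. fat (E n)" "\<And>n. x \<in> triangle (E n)"
    "\<And>n. longest_side (E n) \<le> 1 / Suc n"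
    by blast
  \<comment> \<open>Pairing the ratios lets compactness yield a single subsequence along which both
    converge.\<close>
  define f where "f n = (max_vertex_dist x (E n) / sqrt (area (E n)), longest_side (E n) / sqrt (area (E n)))" for n
  have "f n \<in> {0..sqrt 3} \<times> {0..sqrt 3}" for n
  proof -
    have "max_vertex_dist x (E n) / sqrt (area (E n)) \<le> longest_side (E n) / sqrt (area (E n))"
      using max_vertex_dist_le(1)[OF E(3)] area_pos[OF E(1)] by (intro divide_right_mono) (auto intro: less_imp_le)
    then show ?thesis
      using fat_ratio_le[OF E(1,2), of n] max_vertex_dist_le(2)[OF E(3), of n] longest_side_nonneg[of "E n"]
        area_pos[OF E(1), of n] by (simp add: f_def)
  qed
  moreover have "compact ({0..sqrt 3} \<times> {0..sqrt 3 :: real})"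
    by (intro compact_Times compact_Icc)
  ultimately obtain l r where l: "strict_mono r" "(f \<circ> r) \<longlonglongrightarrow> l"
    by (metis compact_def)
  have "expands x (E \<circ> r)"
    using E LIMSEQ_subseq_LIMSEQ[OF longest_side_tendsto_0[of E 1, OF E(4)] l(1)]
    by (simp add: expands_def o_def)
  moreover have "(\<lambda>n. max_vertex_dist x ((E \<circ> r) n) / sqrt (area ((E \<circ> r) n))) \<longlonglongrightarrow> fst l"
    "(\<lambda>n. longest_side ((E \<circ> r) n) / sqrt (area ((E \<circ> r) n))) \<longlonglongrightarrow> snd l"
    using tendsto_fst[OF l(2)] tendsto_snd[OF l(2)] by (simp_all add: f_def o_def)
  ultimately show ?thesis
    using E(2) by (intro that[of "E \<circ> r" "fst l" "snd l"]) simp_all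
qed

lemma Inter_triangle_expands:
  assumes "expands x E"
  shows "(\<Inter>n. triangle (E n)) = {x}"
proof -
  have "y = x" if "\<And>n. y \<in> triangle (E n)" for y
  proof -
    have "dist y x \<le> longest_side (E n)" for n
      using that assms by (intro dist_triangle_le_longest_side) (auto simp: expands_def)
    moreover have "(\<lambda>n. longest_side (E n)) \<longlonglongrightarrow> 0"
      using assms by (simp add: expands_def)
    ultimately have "dist y x \<le> 0"
      by (intro LIMSEQ_le_const) auto
    then show ?thesis
      by simp
  qed
  then show ?thesis
    using assms by (auto simp: expands_def)
qed

text \<open>Fourth powers reduce this to 9 < 208/23, that is, 207 < 208.\<close>

lemma sqrt_3_less: "sqrt 3 < 2 * (13 / 23 :: real) powr (1 / 4)"
proof (rule power_less_imp_less_base)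
  have "(sqrt 3) ^ 4 = ((sqrt 3)\<^sup>2)\<^sup>2"
    unfolding power_mult [symmetric] by simp
  also have "\<dots> = (9 :: real)"
    by simp
  also have "\<dots> < 16 * (13 / 23 :: real)"
    by simp
  also have "\<dots> = (2 * (13 / 23) powr (1 / 4)) ^ 4"
    by (simp add: power_mult_distrib powr_power)
  finally show "sqrt 3 ^ 4 < (2 * (13 / 23 :: real) powr (1 / 4)) ^ 4" .
qed simp

theorem corollary1p4:
  shows "\<exists>(\<mu> :: real^2 \<Rightarrow> nat \<Rightarrow> int^3^3) (D :: (real^2) set).
    cf_expansion \<mu> \<and>
    closure D = UNIV \<and>
    (\<forall>x\<in>D. rank3_point x) \<and>
    (\<forall>x\<in>D.
      (\<forall>n i j k. i \<noteq> j \<and> j \<noteq> k \<and> i \<noteq> k \<longrightarrow>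
         angle_at (vertex (\<mu> x n) i) (vertex (\<mu> x n) j) (vertex (\<mu> x n) k)
           > arcsin (sqrt 23 / 6)) \<and>
      (\<exists>L L'.
         (\<lambda>n. max_vertex_dist x (\<mu> x n) /
              real_of_int (2 * denom (\<mu> x n) 1 * denom (\<mu> x n) 2 * denom (\<mu> x n) 3) powr (-1/2))
           \<longlonglongrightarrow> L \<and>
         (\<lambda>n. longest_side (\<mu> x n) / sqrt (area (\<mu> x n))) \<longlonglongrightarrow> L' \<and>
         L \<le> L' \<and> L' < 2 * (13/23) powr (1/4)) \<and>
      (\<forall>v :: nat \<Rightarrow> 3.
         (\<forall>n i. denom (\<mu> x n) (v n) \<le> denom (\<mu> x n) i) \<longrightarrow>
         (\<lambda>n. infdist (real_row (\<mu> x n) (v n)) (half_line x)) \<longlonglongrightarrow> 0))"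
proof -
  \<comment> \<open>The expansion is chosen at each point separately; outside
    \<open>generic_points\<close> only \<open>expands\<close> is demanded.\<close>
  let ?P = "\<lambda>x E. expands x E \<and> (x \<in> generic_points \<longrightarrow> (\<forall>n. fat (E n)) \<and>
      (\<exists>L L'. (\<lambda>n. max_vertex_dist x (E n) / sqrt (area (E n))) \<longlonglongrightarrow> L \<and>
        (\<lambda>n. longest_side (E n) / sqrt (area (E n))) \<longlonglongrightarrow> L'))"
  have "\<exists>E. ?P x E" for x
  proof (cases "x \<in> generic_points")
    case True
    then show ?thesis
      by (rule exists_fat_expands) blast
  next
    case False
    then show ?thesis
      using exists_expands by blast
  qed
  then have "\<exists>\<mu>. \<forall>x. ?P x (\<mu> x)"
    by (intro choice allI)
  then obtain \<mu> where P: "\<And>x. ?P x (\<mu> x)"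
    by blast
  then have \<mu>: "expands x (\<mu> x)" "x \<in> generic_points \<Longrightarrow> fat (\<mu> x n)" for x n
    by blast+
  have uni: "unimodular_triangle (\<mu> x n)" and mem: "x \<in> triangle (\<mu> x n)"
    and small: "(\<lambda>n. longest_side (\<mu> x n)) \<longlonglongrightarrow> 0" for x n
    using \<mu>(1)[of x] by (simp_all add: expands_def)
  \<comment> \<open>The normalising factor in the first ratio is \<open>sqrt (area M)\<close>, so
    both ratios share a denominator and compare term by term.\<close>
  have sqrt_area: "real_of_int (2 * denom M 1 * denom M 2 * denom M 3) powr (-1/2) = sqrt (area M)"
    if "unimodular_triangle M" for M
  proof -
    let ?p = "real_of_int (2 * denom M 1 * denom M 2 * denom M 3)"
    have "?p > 0"
      using that by (simp add: unimodular_triangle_def)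
    then have "?p powr (- (1/2)) = 1 / sqrt ?p"
      by (simp only: powr_minus_divide powr_half_sqrt less_imp_le)
    then show ?thesis
      by (simp add: area_unimodular[OF that] real_sqrt_divide)
  qed
  have "cf_expansion \<mu>"
    by (simp add: cf_expansion_def uni Inter_triangle_expands[OF \<mu>(1)])
  moreover have "\<exists>L L'.
         (\<lambda>n. max_vertex_dist x (\<mu> x n) /
              real_of_int (2 * denom (\<mu> x n) 1 * denom (\<mu> x n) 2 * denom (\<mu> x n) 3) powr (-1/2))
           \<longlonglongrightarrow> L \<and>
         (\<lambda>n. longest_side (\<mu> x n) / sqrt (area (\<mu> x n))) \<longlonglongrightarrow> L' \<and>
         L \<le> L' \<and> L' < 2 * (13/23) powr (1/4)" if x: "x \<in> generic_points" for x
  proof -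
    obtain L L' where L: "(\<lambda>n. max_vertex_dist x (\<mu> x n) / sqrt (area (\<mu> x n))) \<longlonglongrightarrow> L"
      and L': "(\<lambda>n. longest_side (\<mu> x n) / sqrt (area (\<mu> x n))) \<longlonglongrightarrow> L'"
      using P[of x] x by blast
    have "max_vertex_dist x (\<mu> x n) / sqrt (area (\<mu> x n)) \<le> longest_side (\<mu> x n) / sqrt (area (\<mu> x n))" for n
      using max_vertex_dist_le(1)[OF mem] area_pos[OF uni] by (intro divide_right_mono) (auto intro: less_imp_le)
    then have "L \<le> L'"
      using L L' by (intro LIMSEQ_le) auto
    moreover have "L' \<le> sqrt 3"
      \<comment> \<open>Strictness could be lost in the limit; the uniform bound
        \<open>sqrt 3\<close>, itself below the constant of the statement, preserves it.\<close>
      using L' fat_ratio_le[OF uni \<mu>(2)[OF x]] by (intro LIMSEQ_le_const2) auto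
    then have "L' < 2 * (13/23) powr (1/4)"
      using sqrt_3_less by linarith
    ultimately show ?thesis
      unfolding sqrt_area[OF uni] using L L' by blast
  qed
  moreover have "(\<lambda>n. infdist (real_row (\<mu> x n) (v n)) (half_line x)) \<longlonglongrightarrow> 0"
    if x: "x \<in> generic_points" and v: "\<And>n i. denom (\<mu> x n) (v n) \<le> denom (\<mu> x n) i" for x v
  proof -
    have "(\<lambda>n. infdist (real_row (\<mu> x n) (v n)) (half_line x) ^ 6) \<longlonglongrightarrow> 0"
    proof (rule tendsto_sandwich[OF always_eventually always_eventually tendsto_const])
      show "(\<lambda>n. 7 * (longest_side (\<mu> x n))\<^sup>2) \<longlonglongrightarrow> 0"
        using tendsto_mult[OF tendsto_const[of 7] tendsto_power[OF small[of x], of 2]] by simp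
    qed (use infdist_half_line_bound[OF uni \<mu>(2)[OF x] mem v] in \<open>auto simp: infdist_nonneg\<close>)
    then show ?thesis
      by simp
  qed
  ultimately show ?thesis
    using closure_generic_points rank3_generic fat_angle[OF \<mu>(2)]
    by (intro exI[of _ \<mu>] exI[of _ generic_points] conjI ballI allI impI) simp_all
qed

end
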